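(* Let $A$ be a commutative ring and let $C$ be a coprime ideal of $A$. If $I,J$ are ideals of $A$ with $C\subseteq I+J$, then $C\subseteq I$ or $C\subseteq J$.
   Context: All rings are commutative with identity. For ideals $I,J$ of a ring $A$, $\operatorname{Ann}(I)=\{a\in A\mid aI=0\}$ and $(J:I)=\{a\in A\mid aI\subseteq J\}$. The coproduct of $I$ and $J$ is the ideal $[I:J]:=(J:\operatorname{Ann}(I))=\{a\in A\mid a\operatorname{Ann}(I)\subseteq J\}$. An ideal $C$ of $A$ is coprime if $C\neq 0$ and, for all ideals $I,J$ of $A$, $C\subseteq [I:J]$ implies $C\subseteq I$ or $C\subseteq J$. *)

theory Defs
  imports "HOL-Algebra.Ideal"
begin

definition annihilator :: "('a, 'b) ring_scheme \<Rightarrow> 'a set \<Rightarrow> 'a set"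
  where "annihilator R I = {a \<in> carrier R. \<forall>x\<in>I. a \<otimes>\<^bsub>R\<^esub> x = \<zero>\<^bsub>R\<^esub>}"

(* The colon ideal (J : I); note the order of the arguments. *)
definition ideal_colon :: "('a, 'b) ring_scheme \<Rightarrow> 'a set \<Rightarrow> 'a set \<Rightarrow> 'a set"
  where "ideal_colon R J I = {a \<in> carrier R. \<forall>x\<in>I. a \<otimes>\<^bsub>R\<^esub> x \<in> J}"

(* The coproduct [I : J] = (J : Ann I); it is not symmetric by definition. *)
definition ideal_coproduct :: "('a, 'b) ring_scheme \<Rightarrow> 'a set \<Rightarrow> 'a set \<Rightarrow> 'a set"
  where "ideal_coproduct R I J = ideal_colon R J (annihilator R I)"

(* Dual to primeness of an ideal; unrelated to comaximality of two ideals. *)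
definition coprime_ideal :: "'a set \<Rightarrow> ('a, 'b) ring_scheme \<Rightarrow> bool"
  where "coprime_ideal C R \<longleftrightarrow>
    ideal C R \<and> C \<noteq> {\<zero>\<^bsub>R\<^esub>} \<and>
    (\<forall>I J. ideal I R \<longrightarrow> ideal J R \<longrightarrow> C \<subseteq> ideal_coproduct R I J \<longrightarrow> C \<subseteq> I \<or> C \<subseteq> J)"

end

theory Submission
  imports Defs
begin

text \<open>The coproduct [I : J] always contains I + J: an element of Ann(I) kills the I-part of i
  + j, and what survives is a multiple of j, hence lies in J. This inclusion is
  \<open>set_add_subset_ideal_coproduct\<close>. A coprime ideal inside I + J is therefore inside
  [I : J], and coprimeness yields the alternative.\<close>

lemma (in cring) set_add_subset_ideal_coproduct:
  assumes "ideal I R" and "ideal J R"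
  shows "I <+>\<^bsub>R\<^esub> J \<subseteq> ideal_coproduct R I J"
proof
  interpret I: ideal I R by fact
  interpret J: ideal J R by fact
  fix c assume "c \<in> I <+>\<^bsub>R\<^esub> J"
  then obtain i j where i: "i \<in> I" and j: "j \<in> J" and c: "c = i \<oplus> j"
    unfolding set_add_def' by blast
  have iC: "i \<in> carrier R" and jC: "j \<in> carrier R"
    using i j by auto
  have "c \<otimes> a \<in> J" if "a \<in> annihilator R I" for a
  proof -
    have aC: "a \<in> carrier R" and ai: "a \<otimes> i = \<zero>"
      using that i by (auto simp: annihilator_def)
    \<comment> \<open>Commutativity is instantiated so that only the first product is flipped: it
      then matches \<open>ai\<close>, while the second keeps the form required by
      \<open>J.I_r_closed\<close>.\<close>
    have "c \<otimes> a = a \<otimes> i \<oplus> j \<otimes> a"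
      using aC iC jC by (simp add: c l_distr m_comm[of i a])
    also have "\<dots> = j \<otimes> a"
      using aC jC by (simp add: ai)
    finally show ?thesis
      using J.I_r_closed[OF j aC] by simp
  qed
  then show "c \<in> ideal_coproduct R I J"
    using iC jC by (auto simp: ideal_coproduct_def ideal_colon_def c)
qed

theorem proposition9:
  fixes A :: "('a, 'b) ring_scheme" and C I J :: "'a set"
  assumes "cring A"
    and "coprime_ideal C A"
    and "ideal I A"
    and "ideal J A"
    and "C \<subseteq> I <+>\<^bsub>A\<^esub> J"
  shows "C \<subseteq> I \<or> C \<subseteq> J"
proof -
  \<comment> \<open>Coprimeness tests containment in coproducts, not in sums, so the assumption is
    first weakened to such a containment.\<close>
  have "C \<subseteq> ideal_coproduct A I J"
    using cring.set_add_subset_ideal_coproduct[OF assms(1,3,4)] assms(5) by blast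
  then show ?thesis
    using assms(2-4) unfolding coprime_ideal_def by blast
qed

end
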